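(* Let $u$ and $v$ be positive real numbers with $u/v$ irrational, and let $\mathcal{T}_{u,v}$ be the triangle with vertices $(0,0)$, $(1/u,0)$, $(0,1/v)$. Assume that $1/u+1/v$ and $u+v$ are rational, but that $\mathcal{T}_{u,v}$ is not a positive integer scaling of a primitive pseudo-rational triangle. Then the sequence $f(n)=I_{\mathcal{T}_{u,v}}(n)=\#(n\mathcal{T}_{u,v}\cap\mathbb{Z}^2)$ is not $\mathcal{P}$-recursive.
   Context: A sequence $f(n)$ is $\mathcal{P}$-recursive (of order $k$) if there are polynomials $p_0,\dots,p_k$, not all zero, such that $p_k(n+k)f(n+k)+\cdots+p_0(n)f(n)=0$ for all nonnegative integers $n$. A polytope is pseudo-rational if its Ehrhart function $t\mapsto\#(t\mathcal{P}\cap\mathbb{Z}^d)$ (for positive integers $t$) is a quasipolynomial, i.e. of the form $\sum_i c_i(t)t^i$ with each $c_i$ periodic of integral period. A pseudo-rational triangle $\mathcal{T}$ is primitive if no scaling $\frac1t\mathcal{T}$ with integer $t>1$ is pseudo-rational. *)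

theory Defs
  imports "HOL-Analysis.Analysis" "HOL-Computational_Algebra.Polynomial"
begin

definition P_recursive :: "(nat \<Rightarrow> complex) \<Rightarrow> bool" where
  "P_recursive f \<longleftrightarrow> (\<exists>(k::nat) (p :: nat \<Rightarrow> complex poly).
      (\<exists>i\<le>k. p i \<noteq> 0) \<and>
      (\<forall>n. (\<Sum>i\<le>k. poly (p i) (of_nat (n + i)) * f (n + i)) = 0))"

definition Z2 :: "(real \<times> real) set" where
  "Z2 = {(of_int i, of_int j) | i j. True}"

definition lattice_count :: "(real \<times> real) set \<Rightarrow> nat \<Rightarrow> nat" where
  "lattice_count P t = card (((\<lambda>x. real t *\<^sub>R x) ` P) \<inter> Z2)"

definition periodic_nat :: "(nat \<Rightarrow> real) \<Rightarrow> bool" where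
  "periodic_nat c \<longleftrightarrow> (\<exists>N::nat. N > 0 \<and> (\<forall>t. c (t + N) = c t))"

definition quasipolynomial :: "(nat \<Rightarrow> real) \<Rightarrow> bool" where
  "quasipolynomial g \<longleftrightarrow> (\<exists>(d::nat) (c :: nat \<Rightarrow> nat \<Rightarrow> real).
      (\<forall>i\<le>d. periodic_nat (c i)) \<and>
      (\<forall>t>0. g t = (\<Sum>i\<le>d. c i t * real t ^ i)))"

definition pseudo_rational :: "(real \<times> real) set \<Rightarrow> bool" where
  "pseudo_rational P \<longleftrightarrow> quasipolynomial (\<lambda>t. real (lattice_count P t))"

definition is_triangle :: "(real \<times> real) set \<Rightarrow> bool" where
  "is_triangle T \<longleftrightarrow> (\<exists>a b c. \<not> collinear {a, b, c} \<and> T = convex hull {a, b, c})"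

definition primitive_pseudo_rational_triangle :: "(real \<times> real) set \<Rightarrow> bool" where
  "primitive_pseudo_rational_triangle T \<longleftrightarrow>
     is_triangle T \<and> pseudo_rational T \<and>
     (\<forall>t::nat. t > 1 \<longrightarrow> \<not> pseudo_rational ((\<lambda>x. (1 / real t) *\<^sub>R x) ` T))"

definition T_uv :: "real \<Rightarrow> real \<Rightarrow> (real \<times> real) set" where
  "T_uv u v = convex hull {(0, 0), (1 / u, 0), (0, 1 / v)}"

end

theory Submission
  imports Defs
begin

text \<open>
  Write \<open>u + v = A / B\<close> in lowest terms, \<open>c = 1 / u + 1 / v\<close>, and let \<open>f n\<close> count the points of
  the dilate. Adding \<open>u + v\<close> to the size of the triangle translates it by \<open>(1, 1)\<close> and adds the points on
  the axes; iterating \<open>B\<close> times, \<open>f (n + A) - f n\<close> is a linear function of \<open>n\<close> minus the sum over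
  \<open>1 \<le> j \<le> B\<close> of \<open>frac g + [frac g < frac z]\<close>, where \<open>g = (n + j A / B) c\<close> is rational and
  \<open>z = (n + j A / B) / u\<close> is irrational. If all \<open>g\<close> are integers, then this sum is the constant \<open>B\<close> and
  \<open>f\<close> is a quasipolynomial. Otherwise the indicator terms are step functions of \<open>n / u\<close> modulo 1 with
  pairwise distinct jumps, also after combining finitely many shifts of \<open>n\<close>, so by density of the fractional
  parts no nontrivial combination of shifts of \<open>f (n + A) - f n - 2 \<alpha> A n\<close> converges. The leading
  coefficients of a recurrence with polynomial coefficients would give such a combination. A quasipolynomial
  \<open>f\<close> would as well, whence \<open>c \<in> \<int>\<close>; applied to \<open>T_uv (t u) (t v)\<close> this gives \<open>t \<le> c\<close>, so a largest
  \<open>t\<close> with \<open>T_uv (t u) (t v)\<close> pseudo-rational exists, and it yields a primitive triangle.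
\<close>

section \<open>Density and jumps of fractional parts\<close>

text \<open>Since \<open>M * \<theta>\<close> is again irrational, density of the fractional parts
  of its multiples applies. Moving the offset \<open>(r + M * K) * \<theta>\<close> into the target
  is what forces \<open>s \<ge> K\<close>.\<close>

lemma fractional_parts_dense_in_progression:
  fixes \<theta> y \<epsilon> :: real and M r K :: nat
  assumes "\<theta> \<notin> \<rat>" "M > 0" "\<epsilon> > 0"
  obtains s :: nat and h :: int where "s \<ge> K" "\<bar>real (r + M * s) * \<theta> - h - y\<bar> < \<epsilon>"
proof -
  have "real M * \<theta> \<notin> \<rat>"
  proof
    assume "real M * \<theta> \<in> \<rat>"
    then have "(real M * \<theta>) / real M \<in> \<rat>"
      by (intro Rats_divide) auto
    with assms show False by simp
  qed
  then obtain h and k :: int where "k > 0" and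
    kh: "\<bar>of_int k * (real M * \<theta>) - of_int h - (y - real (r + M * K) * \<theta>)\<bar> < \<epsilon>"
    using sequence_of_fractional_parts_is_dense[OF _ \<open>\<epsilon> > 0\<close>, of "real M * \<theta>" "y - real (r + M * K) * \<theta>"]
    by blast
  have "real (r + M * (K + nat k)) * \<theta> - h - y
      = of_int k * (real M * \<theta>) - of_int h - (y - real (r + M * K) * \<theta>)"
    using \<open>k > 0\<close> by (simp add: algebra_simps)
  with kh show thesis
    by (intro that[of "K + nat k" h]) auto
qed

lemma frac_add_of_int: "frac (x + of_int h) = frac x"
  by (simp add: frac_def)

text \<open>The indicator can only change where the argument of \<open>frac\<close> is congruent to
  0 or to \<open>\<gamma>\<close> modulo 1. Both are rational, so the irrational \<open>w\<close>
  keeps a positive distance from them.\<close>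

lemma eventually_less_frac_iff:
  fixes w \<gamma> :: real
  assumes "w \<notin> \<rat>" "\<gamma> \<in> \<rat>"
  shows "\<forall>\<^sub>F t in nhds 0. \<gamma> < frac (t + w) \<longleftrightarrow> \<gamma> < frac w"
proof -
  have "w - of_int \<lfloor>w\<rfloor> \<notin> \<rat>"
    using assms by (metis Rats_add Rats_of_int diff_add_cancel)
  then have "frac w \<notin> \<rat>" by (simp add: frac_def)
  then have "frac w \<noteq> 0" "frac w \<noteq> \<gamma>" using assms Rats_0 by metis+
  moreover have "0 \<le> frac w" "frac w < 1" by (auto simp: frac_lt_1)
  ultimately have pos: "min (min (frac w) (1 - frac w)) \<bar>frac w - \<gamma>\<bar> > 0" (is "?d > 0") by auto
  have "\<gamma> < frac (t + w) \<longleftrightarrow> \<gamma> < frac w" if "\<bar>t\<bar> < ?d" for t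
  proof -
    have "frac (t + w) = t + frac w"
      using that by (subst frac_unique_iff) (auto simp: frac_def)
    then show ?thesis using that by auto
  qed
  then show ?thesis
    unfolding eventually_nhds_metric using pos by (auto simp: dist_real_def intro!: exI[of _ ?d])
qed

text \<open>Just left of 0 the fractional part is close to 1, just right of it close to 0; a
  threshold strictly in between detects the sign.\<close>

lemma eventually_less_frac_iff_neg:
  fixes \<gamma> :: real
  assumes "0 < \<gamma>" "\<gamma> < 1"
  shows "\<forall>\<^sub>F t in nhds 0. \<gamma> < frac t \<longleftrightarrow> t < 0"
proof -
  have "\<gamma> < frac t \<longleftrightarrow> t < 0" if t: "\<bar>t\<bar> < min \<gamma> (1 - \<gamma>)" for t
  proof (cases "t < 0")
    case True
    have "frac t = t + 1"
      using t assms True by (subst frac_unique_iff) auto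
    then show ?thesis using t True by auto
  next
    case False
    have "frac t = t"
      using t assms False by (subst frac_unique_iff) auto
    then show ?thesis using t False by auto
  qed
  then show ?thesis
    unfolding eventually_nhds_metric using assms
    by (auto simp: dist_real_def intro!: exI[of _ "min \<gamma> (1 - \<gamma>)"])
qed

text \<open>Near the point \<open>- \<omega> i\<^sub>0\<close> only the summand \<open>i\<^sub>0\<close> jumps, and the progression visits both
  sides of that point infinitely often.\<close>
lemma threshold_sum_not_convergent:
  fixes \<theta> :: real and \<omega> \<gamma> :: "'i \<Rightarrow> real" and b :: "'i \<Rightarrow> complex" and M r :: nat
  assumes S: "finite S" "i\<^sub>0 \<in> S" and b: "b i\<^sub>0 \<noteq> 0"
    and \<gamma>: "0 < \<gamma> i\<^sub>0" "\<gamma> i\<^sub>0 < 1" "\<And>i. i \<in> S \<Longrightarrow> \<gamma> i \<in> \<rat>"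
    and \<omega>: "\<And>i. i \<in> S \<Longrightarrow> i \<noteq> i\<^sub>0 \<Longrightarrow> \<omega> i - \<omega> i\<^sub>0 \<notin> \<rat>"
    and \<theta>: "\<theta> \<notin> \<rat>" "M > 0"
  shows "\<not> convergent (\<lambda>s. \<Sum>i\<in>S. b i * of_bool (\<gamma> i < frac (real (r + M * s) * \<theta> + \<omega> i)))"
    (is "\<not> convergent ?X")
proof
  assume "convergent ?X"
  then have "Cauchy ?X" by (rule convergent_Cauchy)
  \<comment> \<open>\<open>F\<close> is the sum as a function of the displacement \<open>t\<close>
    from the jump point; \<open>C\<close> gathers the summands that are constant near
    \<open>t = 0\<close>.\<close>
  define F where "F = (\<lambda>t. \<Sum>i\<in>S. b i * of_bool (\<gamma> i < frac (t + (\<omega> i - \<omega> i\<^sub>0))))"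
  define C where "C = (\<Sum>i\<in>S - {i\<^sub>0}. b i * of_bool (\<gamma> i < frac (\<omega> i - \<omega> i\<^sub>0)))"
  have "\<forall>\<^sub>F t in nhds 0. \<forall>i\<in>S - {i\<^sub>0}. \<gamma> i < frac (t + (\<omega> i - \<omega> i\<^sub>0)) \<longleftrightarrow> \<gamma> i < frac (\<omega> i - \<omega> i\<^sub>0)"
    using S \<gamma> \<omega> by (intro eventually_ball_finite ballI eventually_less_frac_iff) auto
  moreover have "\<forall>\<^sub>F t in nhds 0. \<gamma> i\<^sub>0 < frac t \<longleftrightarrow> t < 0"
    by (rule eventually_less_frac_iff_neg) fact+
  ultimately have "\<forall>\<^sub>F t in nhds 0. F t = C + b i\<^sub>0 * of_bool (t < 0)"
    by eventually_elim (simp add: F_def C_def sum.remove[OF S])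
  then obtain \<delta> where "\<delta> > 0" and \<delta>: "\<And>t. \<bar>t\<bar> < \<delta> \<Longrightarrow> F t = C + b i\<^sub>0 * of_bool (t < 0)"
    by (auto simp: eventually_nhds_metric dist_real_def)
  have X: "?X s = F (real (r + M * s) * \<theta> - of_int h + \<omega> i\<^sub>0)" for s h
  proof -
    have "frac (real (r + M * s) * \<theta> + \<omega> i)
        = frac (real (r + M * s) * \<theta> - of_int h + \<omega> i\<^sub>0 + (\<omega> i - \<omega> i\<^sub>0))" for i
      using frac_add_of_int[of "real (r + M * s) * \<theta> - of_int h + \<omega> i" h] by (simp add: algebra_simps)
    then show ?thesis by (simp add: F_def)
  qed
  from CauchyD[OF \<open>Cauchy ?X\<close>, of "norm (b i\<^sub>0)"] b obtain K where K: "\<And>m n. m \<ge> K \<Longrightarrow> n \<ge> K \<Longrightarrow> norm (?X m - ?X n) < norm (b i\<^sub>0)"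
    by auto
  \<comment> \<open>Targets at distance \<open>\<delta> / 2\<close> on either side of the jump
    point, with tolerance \<open>\<delta> / 2\<close>, keep the displacements within
    \<open>\<delta>\<close> and fix their signs. The two values then differ by exactly
    \<open>b i\<^sub>0\<close>.\<close>
  obtain m h where m: "m \<ge> K" "\<bar>real (r + M * m) * \<theta> - of_int h - (- \<omega> i\<^sub>0 - \<delta> / 2)\<bar> < \<delta> / 2"
    using fractional_parts_dense_in_progression[OF \<theta>, of "\<delta> / 2" K r "- \<omega> i\<^sub>0 - \<delta> / 2"] \<open>\<delta> > 0\<close> by auto
  obtain n h' where n: "n \<ge> K" "\<bar>real (r + M * n) * \<theta> - of_int h' - (- \<omega> i\<^sub>0 + \<delta> / 2)\<bar> < \<delta> / 2"
    using fractional_parts_dense_in_progression[OF \<theta>, of "\<delta> / 2" K r "- \<omega> i\<^sub>0 + \<delta> / 2"] \<open>\<delta> > 0\<close> by auto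
  have t: "\<bar>real (r + M * m) * \<theta> - of_int h + \<omega> i\<^sub>0\<bar> < \<delta>" "real (r + M * m) * \<theta> - of_int h + \<omega> i\<^sub>0 < 0"
    using m(2) \<open>\<delta> > 0\<close> by argo+
  have t': "\<bar>real (r + M * n) * \<theta> - of_int h' + \<omega> i\<^sub>0\<bar> < \<delta>" "\<not> real (r + M * n) * \<theta> - of_int h' + \<omega> i\<^sub>0 < 0"
    using n(2) \<open>\<delta> > 0\<close> by argo+
  have "?X m = F (real (r + M * m) * \<theta> - of_int h + \<omega> i\<^sub>0)" by (rule X)
  also have "\<dots> = C + b i\<^sub>0"
    using t(2) by (simp only: \<delta>[OF t(1)]) simp
  finally have "?X m = C + b i\<^sub>0" .
  moreover have "?X n = C"
  proof -
    have "?X n = F (real (r + M * n) * \<theta> - of_int h' + \<omega> i\<^sub>0)" by (rule X)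
    also have "\<dots> = C"
      using t'(2) by (simp only: \<delta>[OF t'(1)]) simp
    finally show ?thesis .
  qed
  ultimately show False
    using K[OF m(1) n(1)] by simp
qed

section \<open>The sum over the translations and its jumps\<close>

text \<open>Later \<open>a = u + v\<close>, \<open>c = 1 / u + 1 / v\<close> and
  \<open>\<theta> = 1 / u\<close>. The \<open>j\<close>-th summand is then what rounding down costs
  in the \<open>j\<close>-th translation by \<open>(1, 1)\<close>.\<close>

definition window_sum :: "real \<Rightarrow> real \<Rightarrow> real \<Rightarrow> nat \<Rightarrow> nat \<Rightarrow> real" where
  "window_sum \<theta> c a B n = (\<Sum>j=1..B. frac ((real n + real j * a) * c)
     + of_bool (frac ((real n + real j * a) * c) < frac ((real n + real j * a) * \<theta>)))"

text \<open>Clearing the denominator shows that \<open>B\<close> divides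
  \<open>(j' - j) * A\<close>, hence \<open>j' - j\<close>, which is smaller than \<open>B\<close>
  in absolute value. This separates the jumps: those of distinct pairs \<open>(i, j)\<close> lie a
  nonzero rational multiple of \<open>\<theta>\<close> apart.\<close>

lemma coprime_step_eq:
  fixes i i' j j' A B :: nat
  assumes "coprime A B" "B > 0" "j \<in> {1..B}" "j' \<in> {1..B}"
    and eq: "(real i - real i') + (real j - real j') * (real A / real B) = 0"
  shows "i = i' \<and> j = j'"
proof -
  have "(real i - real i') * real B + (real j - real j') * real A = 0"
    using eq \<open>B > 0\<close> by (simp add: field_simps)
  then have "real_of_int ((int i - int i') * int B + (int j - int j') * int A) = 0"
    by simp
  then have eq': "(int i - int i') * int B = (int j' - int j) * int A"
    unfolding of_int_eq_0_iff by (simp add: algebra_simps)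
  then have "int B dvd (int j' - int j) * int A"
    by (metis dvd_triv_right)
  then have "int B dvd int j' - int j"
    using \<open>coprime A B\<close> by (simp add: coprime_commute coprime_dvd_mult_left_iff)
  moreover have "\<bar>int j' - int j\<bar> < int B"
    using assms(3,4) by auto
  ultimately have "int j' - int j = 0"
    using zdvd_imp_le[of "int B" "\<bar>int j' - int j\<bar>"] by force
  then show ?thesis using eq' \<open>B > 0\<close> by simp
qed

text \<open>Along steps of length \<open>M\<close> the rational thresholds do not change, because
  \<open>M * c\<close> is an integer. The combination is thus a constant plus a threshold sum over
  pairs \<open>(i, j)\<close>, and a non-integral value would supply a threshold strictly between 0
  and 1, which excludes convergence.\<close>

lemma window_sum_convergent_imp_Ints:
  fixes \<theta> c :: real and A B M k :: nat and b :: "nat \<Rightarrow> complex"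
  assumes \<theta>: "\<theta> \<notin> \<rat>" and c: "c \<in> \<rat>" and AB: "coprime A B" "A > 0" "B > 0"
    and M: "M > 0" "real M * c \<in> \<int>" and b: "b i\<^sub>0 \<noteq> 0" "i\<^sub>0 \<le> k"
    and conv: "\<And>r. convergent (\<lambda>s. \<Sum>i\<le>k. b i * of_real (window_sum \<theta> c (A / B) B (r + M * s + i)))"
    and j\<^sub>0: "j\<^sub>0 \<in> {1..B}"
  shows "(real n + real j\<^sub>0 * (A / B)) * c \<in> \<int>"
proof (rule ccontr)
  assume nonint: "(real n + real j\<^sub>0 * (A / B)) * c \<notin> \<int>"
  define a where "a = real A / real B"
  \<comment> \<open>Chosen so that \<open>r + i\<^sub>0 = n + M * i\<^sub>0\<close>: the index
    \<open>i\<^sub>0\<close> sees \<open>n\<close> up to a multiple of \<open>M\<close>, and no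
    subtraction \<open>n - i\<^sub>0\<close> is needed in the naturals.\<close>
  define r where "r = n + i\<^sub>0 * (M - 1)"
  define S where "S = {..k} \<times> {1..B}"
  define \<gamma> where "\<gamma> = (\<lambda>(i,j). frac ((real (r + i) + real j * a) * c))"
  define \<omega> where "\<omega> = (\<lambda>(i,j). (real i + real j * a) * \<theta>)"
  have ratl: "(real p + real q * a) * c \<in> \<rat>" for p q
    using c by (auto simp: a_def)
  have shift: "frac (x + real s * (real M * c)) = frac x" for x s
  proof -
    have "real s * (real M * c) \<in> \<int>" by (rule Ints_mult[OF Ints_of_nat M(2)])
    then obtain h where "real s * (real M * c) = of_int h" by (elim Ints_cases)
    then show ?thesis by (simp only: frac_add_of_int)
  qed
  have r: "r + i\<^sub>0 = n + M * i\<^sub>0"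
    using \<open>M > 0\<close> by (cases M) (auto simp: r_def)
  have "(real (r + i\<^sub>0) + real j\<^sub>0 * a) * c = (real n + real j\<^sub>0 * a) * c + real i\<^sub>0 * (real M * c)"
    unfolding r by (simp add: algebra_simps)
  then have \<gamma>0: "\<gamma> (i\<^sub>0, j\<^sub>0) = frac ((real n + real j\<^sub>0 * a) * c)"
    by (simp add: \<gamma>_def shift)
  have "\<not> convergent (\<lambda>s. \<Sum>p\<in>S. (case p of (i, j) \<Rightarrow> b i)
      * of_bool (\<gamma> p < frac (real (r + M * s) * \<theta> + \<omega> p)))"
  proof (rule threshold_sum_not_convergent[of _ "(i\<^sub>0, j\<^sub>0)"])
    show "0 < \<gamma> (i\<^sub>0, j\<^sub>0)" "\<gamma> (i\<^sub>0, j\<^sub>0) < 1"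
      using nonint unfolding \<gamma>0 by (auto simp: frac_lt_1 a_def)
    show "\<gamma> p \<in> \<rat>" for p
      using ratl[of "r + fst p" "snd p"] by (auto simp: \<gamma>_def frac_def split: prod.split)
    show "\<omega> p - \<omega> (i\<^sub>0, j\<^sub>0) \<notin> \<rat>" if p: "p \<in> S" "p \<noteq> (i\<^sub>0, j\<^sub>0)" for p
    proof
      assume rat: "\<omega> p - \<omega> (i\<^sub>0, j\<^sub>0) \<in> \<rat>"
      obtain i j where ij: "p = (i, j)" by fastforce
      define d where "d = (real i - real i\<^sub>0) + (real j - real j\<^sub>0) * a"
      have "d \<noteq> 0"
        using coprime_step_eq[of A B j j\<^sub>0 i i\<^sub>0] p j\<^sub>0 AB by (auto simp: d_def a_def ij S_def)
      moreover have "d \<in> \<rat>" by (auto simp: d_def a_def)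
      moreover have "\<omega> p - \<omega> (i\<^sub>0, j\<^sub>0) = d * \<theta>"
        by (simp add: \<omega>_def d_def ij algebra_simps)
      ultimately have "\<theta> \<in> \<rat>"
        using rat Rats_divide[of "d * \<theta>" d] by simp
      with \<theta> show False by simp
    qed
  qed (use b j\<^sub>0 \<theta> M in \<open>auto simp: S_def\<close>)
  moreover have "(\<lambda>s. \<Sum>i\<le>k. b i * of_real (window_sum \<theta> c a B (r + M * s + i)))
     = (\<lambda>s. (\<Sum>p\<in>S. (case p of (i, j) \<Rightarrow> b i) * of_real (\<gamma> p))
          + (\<Sum>p\<in>S. (case p of (i, j) \<Rightarrow> b i)
              * of_bool (\<gamma> p < frac (real (r + M * s) * \<theta> + \<omega> p))))"
  proof
    fix s
    have *: "(real (r + M * s + i) + real j * a) * c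
        = (real (r + i) + real j * a) * c + real s * (real M * c)" for i j
      by (simp add: algebra_simps)
    have **: "(real (r + M * s + i) + real j * a) * \<theta> = real (r + M * s) * \<theta> + \<omega> (i, j)" for i j
      by (simp add: \<omega>_def algebra_simps)
    show "(\<Sum>i\<le>k. b i * of_real (window_sum \<theta> c a B (r + M * s + i)))
      = (\<Sum>p\<in>S. (case p of (i, j) \<Rightarrow> b i) * of_real (\<gamma> p))
          + (\<Sum>p\<in>S. (case p of (i, j) \<Rightarrow> b i)
              * of_bool (\<gamma> p < frac (real (r + M * s) * \<theta> + \<omega> p)))"
      unfolding window_sum_def * ** shift S_def sum.distrib[symmetric] distrib_left[symmetric]
        sum.cartesian_product'
      by (auto simp: sum_distrib_left \<gamma>_def case_prod_unfold of_bool_def intro!: sum.cong)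
  qed
  ultimately show False
    using conv[of r] unfolding a_def[symmetric] by (simp add: convergent_add_const_iff)
qed

section \<open>Asymptotics of recurrences with polynomial coefficients\<close>

lemma degree_eq_0_if_bounded_on_nats:
  fixes T :: "complex poly"
  assumes "Bseq (\<lambda>n. poly T (of_nat n))"
  shows "degree T = 0"
proof (rule ccontr)
  assume "degree T \<noteq> 0"
  then have "filterlim (poly T) at_infinity at_infinity"
    by (intro filterlim_poly_at_infinity) auto
  moreover have "filterlim (of_nat :: nat \<Rightarrow> complex) at_infinity sequentially"
    by (rule tendsto_of_nat)
  ultimately have "filterlim (\<lambda>n. poly T (of_nat n)) at_infinity sequentially"
    by (rule filterlim_compose)
  moreover obtain K where K: "K > 0" "\<And>n. norm (poly T (of_nat n)) \<le> K"
    using assms by (auto simp: Bseq_def)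
  ultimately have "\<forall>\<^sub>F n in sequentially. norm (poly T (of_nat n)) \<ge> K + 1"
    using filterlim_at_infinity[of 0 "\<lambda>n. poly T (of_nat n)" sequentially] by auto
  then obtain n where "norm (poly T (of_nat n)) \<ge> K + 1"
    by (auto dest: eventually_happens)
  with K(2)[of n] show False by simp
qed

text \<open>As a polynomial in \<open>1 / n\<close>, the quotient has a visible limit, and its
  variation can be estimated power by power.\<close>

lemma scaled_poly_eq:
  fixes R :: "complex poly"
  assumes "degree R \<le> D" "n > 0"
  shows "poly R (of_nat n) / of_nat n ^ D = (\<Sum>l\<le>D. coeff R l * (1 / of_nat n) ^ (D - l))"
proof -
  have "poly R (of_nat n) = (\<Sum>l\<le>D. coeff R l * of_nat n ^ l)"
    unfolding poly_altdef using assms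
    by (intro sum.mono_neutral_left) (auto simp: coeff_eq_0)
  then show ?thesis
    using \<open>n > 0\<close> by (auto simp: sum_divide_distrib power_diff power_one_over intro!: sum.cong)
qed

lemma scaled_poly_tendsto:
  fixes R :: "complex poly"
  assumes "degree R \<le> D"
  shows "(\<lambda>n. poly R (of_nat n) / of_nat n ^ D) \<longlonglongrightarrow> coeff R D"
proof -
  have "(\<lambda>n. \<Sum>l\<le>D. coeff R l * (1 / of_nat n) ^ (D - l)) \<longlonglongrightarrow> (\<Sum>l\<le>D. coeff R l * 0 ^ (D - l))"
    by (intro tendsto_intros lim_1_over_n)
  also have "(\<Sum>l\<le>D. coeff R l * 0 ^ (D - l)) = (\<Sum>l\<in>{D}. coeff R l * 0 ^ (D - l))"
    by (intro sum.mono_neutral_right) auto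
  finally have "(\<lambda>n. \<Sum>l\<le>D. coeff R l * (1 / of_nat n) ^ (D - l)) \<longlonglongrightarrow> coeff R D"
    by simp
  then show ?thesis
    by (rule Lim_transform_eventually)
      (use assms in \<open>auto intro!: eventually_mono[OF eventually_gt_at_top[of 0]] simp: scaled_poly_eq\<close>)
qed

text \<open>A shift by \<open>A\<close> changes each power of \<open>1 / n\<close> by at most a
  constant times \<open>1 / n ^ 2\<close>. The spare factor \<open>n\<close> is there to absorb a
  sequence of linear growth.\<close>

lemma scaled_poly_diff_tendsto:
  fixes R :: "complex poly"
  assumes "degree R \<le> D"
  shows "(\<lambda>n. of_nat n * (poly R (of_nat (n + A)) / of_nat (n + A) ^ D - poly R (of_nat n) / of_nat n ^ D)) \<longlonglongrightarrow> 0"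
proof -
  have "(\<lambda>n. of_nat n * ((1 / of_nat (n + A)) ^ m - (1 / of_nat n) ^ m) :: complex) \<longlonglongrightarrow> 0" for m
  proof (rule Lim_null_comparison)
    show "\<forall>\<^sub>F n in sequentially. norm (of_nat n * ((1 / of_nat (n + A)) ^ m - (1 / of_nat n) ^ m) :: complex)
        \<le> real m * real A * (1 / real n)"
      using eventually_gt_at_top[of 0]
    proof eventually_elim
      case (elim n)
      have "norm ((1 / of_nat (n + A)) ^ m - (1 / of_nat n) ^ m :: complex)
          \<le> real m * norm (1 / of_nat (n + A) - 1 / of_nat n :: complex)"
        using elim by (intro norm_power_diff) (auto simp: norm_divide simp del: of_nat_add)
      also have "(1 / of_nat (n + A) - 1 / of_nat n :: complex) = - of_real (real A / (real n * real (n + A)))"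
        using elim by (simp add: divide_simps flip: of_nat_add) (simp add: algebra_simps)
      also have "norm \<dots> = real A / (real n * real (n + A))"
        unfolding norm_minus_cancel norm_of_real by simp
      finally have "real n * norm ((1 / of_nat (n + A)) ^ m - (1 / of_nat n) ^ m :: complex)
          \<le> real n * (real m * (real A / (real n * real (n + A))))"
        by (intro mult_left_mono) auto
      also have "\<dots> = real m * real A * (1 / real (n + A))"
        using elim by (simp del: of_nat_add)
      also have "\<dots> \<le> real m * real A * (1 / real n)"
        using elim by (intro mult_left_mono divide_left_mono) auto
      finally show ?case by (simp add: norm_mult del: of_nat_add)
    qed
    show "(\<lambda>n. real m * real A * (1 / real n)) \<longlonglongrightarrow> 0"
      by (intro tendsto_mult_right_zero lim_1_over_n)
  qed
  then have "(\<lambda>n. \<Sum>l\<le>D. coeff R l * (of_nat n * ((1 / of_nat (n + A)) ^ (D - l) - (1 / of_nat n) ^ (D - l)))) \<longlonglongrightarrow> (\<Sum>l\<le>D. coeff R l * 0)"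
    by (intro tendsto_intros)
  then have "(\<lambda>n. \<Sum>l\<le>D. coeff R l * (of_nat n * ((1 / of_nat (n + A)) ^ (D - l) - (1 / of_nat n) ^ (D - l)))) \<longlonglongrightarrow> 0"
    by simp
  then show ?thesis
  proof (rule Lim_transform_eventually)
    show "\<forall>\<^sub>F n in sequentially.
       (\<Sum>l\<le>D. coeff R l * (of_nat n * ((1 / of_nat (n + A)) ^ (D - l) - (1 / of_nat n) ^ (D - l)))) =
       of_nat n * (poly R (of_nat (n + A)) / of_nat (n + A) ^ D - poly R (of_nat n) / of_nat n ^ D)"
      using eventually_gt_at_top[of 0]
    proof eventually_elim
      case (elim n)
      then show ?case
        using scaled_poly_eq[OF assms, of n] scaled_poly_eq[OF assms, of "n + A"]
        by (simp add: sum_distrib_left sum_subtractf algebra_simps del: of_nat_add)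
    qed
  qed
qed

text \<open>Induction in steps of \<open>A\<close>, with a constant that dominates both
  \<open>C\<close> and the first \<open>A\<close> values.\<close>

lemma linear_growth_if_bounded_difference:
  fixes e H :: "nat \<Rightarrow> complex"
  assumes "A > 0" and step: "\<And>n. e (n + A) = e n + H n" and H: "\<And>n. norm (H n) \<le> C"
  obtains C' where "C' \<ge> 0" "\<And>n. norm (e n) \<le> C' * (real n + 1)"
proof -
  define C' where "C' = C + (\<Sum>m<A. norm (e m))"
  have "C \<ge> 0" using H[of 0] norm_ge_zero order_trans by blast
  then have C': "C \<le> C'" "C' \<ge> 0" by (auto simp: C'_def sum_nonneg)
  have "norm (e n) \<le> C' * (real n + 1)" for n
  proof (induction n rule: less_induct)
    case (less n)
    show ?case
    proof (cases "n < A")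
      case True
      then have "norm (e n) \<le> (\<Sum>m<A. norm (e m))"
        by (intro member_le_sum) auto
      also have "\<dots> \<le> C'" using \<open>C \<ge> 0\<close> by (simp add: C'_def)
      also have "\<dots> \<le> C' * (real n + 1)" using C' by (simp add: algebra_simps)
      finally show ?thesis .
    next
      case False
      define m where "m = n - A"
      have n: "n = m + A" using False by (simp add: m_def)
      have "norm (e n) \<le> norm (e m) + norm (H m)"
        unfolding n step by (rule norm_triangle_ineq)
      also have "\<dots> \<le> C' * (real m + 1) + C'"
        using less.IH[of m] H[of m] C' n \<open>A > 0\<close> by (intro add_mono) auto
      also have "\<dots> = C' * (real m + 1 + 1)"
        by (simp add: algebra_simps)
      also have "\<dots> \<le> C' * (real n + 1)"
        using C' \<open>A > 0\<close> by (intro mult_left_mono) (auto simp: n)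
      finally show ?thesis .
    qed
  qed
  with C' that show thesis by blast
qed

text \<open>Divide the recurrence by \<open>n ^ D\<close> and take the difference with step \<open>A\<close>: since \<open>e\<close> grows at most
  linearly and the scaled coefficients vary by \<open>o(1 / n)\<close>, only their limits survive.\<close>
lemma leading_coeff_combination_convergent:
  fixes e H :: "nat \<Rightarrow> complex" and P :: "nat \<Rightarrow> complex poly"
  assumes "A > 0" and step: "\<And>n. e (n + A) = e n + H n" and H: "\<And>n. norm (H n) \<le> C"
    and deg: "\<And>i. i \<le> k \<Longrightarrow> degree (P i) \<le> D"
    and rec: "\<And>n. (\<Sum>i\<le>k. poly (P i) (of_nat n) * e (n + i)) = poly Q (of_nat n)"
  shows "convergent (\<lambda>n. \<Sum>i\<le>k. coeff (P i) D * H (n + i))"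
proof -
  define \<rho> where "\<rho> = (\<lambda>R n. poly R (of_nat n) / of_nat n ^ D :: complex)"
  define W where "W = (\<lambda>n. \<Sum>i\<le>k. coeff (P i) D * H (n + i))"
  \<comment> \<open>Division with remainder splits \<open>Q / n ^ D\<close> into the polynomial
    \<open>S\<close> and a convergent part from \<open>Rm\<close>; \<open>T\<close> is the
    difference of \<open>S\<close> with step \<open>A\<close>.\<close>
  define S where "S = Q div monom 1 D"
  define Rm where "Rm = Q mod monom 1 D"
  define T where "T = pcompose S [:of_nat A, 1:] - S"
  obtain C' where C': "C' \<ge> 0" "\<And>n. norm (e n) \<le> C' * (real n + 1)"
    using linear_growth_if_bounded_difference[of A e H C] \<open>A > 0\<close> step H by blast
  have "degree Rm \<le> D"
    unfolding Rm_def using degree_mod_less[of "monom 1 D :: complex poly" Q]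
    by (auto simp: degree_monom_eq)
  have "Q = S * monom 1 D + Rm"
    by (simp only: S_def Rm_def div_mult_mod_eq)
  then have Q: "poly Q x = poly S x * x ^ D + poly Rm x" for x
    by (metis poly_add poly_mult poly_monom mult_1)
  have V: "(\<Sum>i\<le>k. \<rho> (P i) n * e (n + i)) = poly S (of_nat n) + \<rho> Rm n" if "n > 0" for n
  proof -
    have "(\<Sum>i\<le>k. \<rho> (P i) n * e (n + i)) = poly Q (of_nat n) / of_nat n ^ D"
      by (simp add: rec[symmetric] sum_divide_distrib \<rho>_def)
    then show ?thesis using that by (simp add: Q \<rho>_def field_simps)
  qed
  have T: "poly T (of_nat n) = poly S (of_nat (n + A)) - poly S (of_nat n)" for n
    by (simp add: T_def poly_pcompose add.commute)

  have lim1: "(\<lambda>n. \<Sum>i\<le>k. (\<rho> (P i) (n + A) - \<rho> (P i) n) * e (n + A + i)) \<longlonglongrightarrow> 0"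
  proof (rule tendsto_null_sum)
    fix i assume "i \<in> {..k}"
    then have "(\<lambda>n. of_nat n * (\<rho> (P i) (n + A) - \<rho> (P i) n)) \<longlonglongrightarrow> 0"
      unfolding \<rho>_def using deg by (intro scaled_poly_diff_tendsto) auto
    moreover have "\<forall>\<^sub>F n in sequentially. norm (e (n + A + i) / of_nat n) \<le> C' * (real A + real i + 2)"
      using eventually_ge_at_top[of 1]
    proof eventually_elim
      show "norm (e (n + A + i) / of_nat n) \<le> C' * (real A + real i + 2)" if "n \<ge> 1" for n
      proof -
        have "norm (e (n + A + i)) \<le> C' * (real (n + A + i) + 1)" by (rule C')
        also have "real (n + A + i) + 1 \<le> (real A + real i + 2) * real n"
        proof -
          have "real (n + A + i) + 1 = real n + (real A + real i + 1) * 1" by simp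
          also have "\<dots> \<le> real n + (real A + real i + 1) * real n"
            using that by (intro add_left_mono mult_left_mono) auto
          finally show ?thesis by (simp add: algebra_simps)
        qed
        finally show ?thesis
          using that C'(1) by (simp add: norm_divide divide_simps mult_left_mono mult.assoc)
      qed
    qed
    ultimately have "(\<lambda>n. (of_nat n * (\<rho> (P i) (n + A) - \<rho> (P i) n)) * (e (n + A + i) / of_nat n)) \<longlonglongrightarrow> 0"
      by (rule lim_null_mult_right_bounded)
    then show "(\<lambda>n. (\<rho> (P i) (n + A) - \<rho> (P i) n) * e (n + A + i)) \<longlonglongrightarrow> 0"
      by (rule Lim_transform_eventually)
        (rule eventually_mono[OF eventually_gt_at_top[of 0]], simp)
  qed
  have lim2: "(\<lambda>n. \<Sum>i\<le>k. (\<rho> (P i) n - coeff (P i) D) * H (n + i)) \<longlonglongrightarrow> 0"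
  proof (rule tendsto_null_sum)
    fix i assume "i \<in> {..k}"
    then have "(\<lambda>n. \<rho> (P i) n - coeff (P i) D) \<longlonglongrightarrow> 0"
      unfolding \<rho>_def using deg scaled_poly_tendsto by (intro LIM_zero) auto
    then show "(\<lambda>n. (\<rho> (P i) n - coeff (P i) D) * H (n + i)) \<longlonglongrightarrow> 0"
      by (rule lim_null_mult_right_bounded[where B = C]) (simp add: H)
  qed
  have "\<rho> Rm \<longlonglongrightarrow> coeff Rm D"
    unfolding \<rho>_def by (rule scaled_poly_tendsto) fact
  then have "(\<lambda>n. \<rho> Rm (n + A) - \<rho> Rm n) \<longlonglongrightarrow> coeff Rm D - coeff Rm D"
    by (intro tendsto_diff LIMSEQ_ignore_initial_segment)
  then have lim3: "(\<lambda>n. \<rho> Rm (n + A) - \<rho> Rm n) \<longlonglongrightarrow> 0" by simp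
  have "(\<lambda>n. (\<Sum>i\<le>k. (\<rho> (P i) (n + A) - \<rho> (P i) n) * e (n + A + i))
      + (\<Sum>i\<le>k. (\<rho> (P i) n - coeff (P i) D) * H (n + i)) - (\<rho> Rm (n + A) - \<rho> Rm n)) \<longlonglongrightarrow> 0 + 0 - 0"
    by (intro tendsto_intros lim1 lim2 lim3)
  \<comment> \<open>Subtracting the scaled recurrence at \<open>n\<close> from the one at
    \<open>n + A\<close> expresses \<open>T - W\<close> through the three null sequences.\<close>
  then have lim: "(\<lambda>n. poly T (of_nat n) - W n) \<longlonglongrightarrow> 0"
  proof (simp, elim Lim_transform_eventually, use eventually_gt_at_top[of 0] in eventually_elim)
    case (elim n)
    have "poly T (of_nat n) + (\<rho> Rm (n + A) - \<rho> Rm n)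
        = (\<Sum>i\<le>k. \<rho> (P i) (n + A) * e (n + A + i)) - (\<Sum>i\<le>k. \<rho> (P i) n * e (n + i))"
      using elim V[of n] V[of "n + A"] by (simp add: T)
    also have "\<dots> = (\<Sum>i\<le>k. (\<rho> (P i) (n + A) - \<rho> (P i) n) * e (n + A + i)) + (\<Sum>i\<le>k. \<rho> (P i) n * H (n + i))"
      unfolding sum_subtractf[symmetric] sum.distrib[symmetric]
      using step[of "n + i" for i] by (intro sum.cong) (auto simp: algebra_simps)
    finally show ?case
      by (simp add: W_def algebra_simps sum_subtractf)
  qed
  \<comment> \<open>As \<open>W\<close> is bounded, so is \<open>T\<close> on the naturals; hence
    \<open>T\<close> is a constant, and this constant is the limit of \<open>W\<close>.\<close>
  have W: "norm (W n) \<le> (\<Sum>i\<le>k. norm (coeff (P i) D) * C)" for n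
    unfolding W_def by (rule sum_norm_le) (auto simp: norm_mult H mult_left_mono)
  have "Bseq (\<lambda>n. poly T (of_nat n) - W n)"
    using lim by (intro convergent_imp_Bseq convergentI)
  then obtain L where L: "norm (poly T (of_nat n) - W n) \<le> L" for n
    by (auto simp: Bseq_def)
  have "Bseq (\<lambda>n. poly T (of_nat n))"
  proof (rule BseqI')
    show "norm (poly T (of_nat n)) \<le> L + (\<Sum>i\<le>k. norm (coeff (P i) D) * C)" for n
      using norm_triangle_ineq[of "poly T (of_nat n) - W n" "W n"] L[of n] W[of n] by simp
  qed
  then have "degree T = 0"
    by (rule degree_eq_0_if_bounded_on_nats)
  then obtain t where "T = [:t:]" by (rule degree_eq_zeroE)
  with lim have "(\<lambda>n. t - (t - W n)) \<longlonglongrightarrow> t - 0"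
    by (intro tendsto_intros) simp
  then show ?thesis by (auto simp: convergent_def W_def)
qed

section \<open>Counting lattice points of the triangle\<close>

text \<open>The size \<open>t\<close> is real because the translations pass through the sizes
  \<open>n + j * (A / B)\<close>, which need not be integers.\<close>

definition triangle_points :: "real \<Rightarrow> real \<Rightarrow> real \<Rightarrow> (nat \<times> nat) set" where
  "triangle_points u v t = {(x, y). u * real x + v * real y \<le> t}"

lemma T_uv_eq:
  assumes "u > 0" "v > 0"
  shows "T_uv u v = {(x, y). 0 \<le> x \<and> 0 \<le> y \<and> u * x + v * y \<le> 1}"
proof -
  have "T_uv u v = {(x, y). \<exists>p q r. 0 \<le> p \<and> 0 \<le> q \<and> 0 \<le> r \<and> p + q + r = 1 \<and> x = q / u \<and> y = r / v}"
    by (auto simp: T_uv_def convex_hull_3)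
  also have "\<dots> = {(x, y). 0 \<le> x \<and> 0 \<le> y \<and> u * x + v * y \<le> 1}"
  proof (intro subset_antisym subsetI)
    fix s assume "s \<in> {(x, y). 0 \<le> x \<and> 0 \<le> y \<and> u * x + v * y \<le> 1}"
    then obtain x y where "s = (x, y)" "0 \<le> x" "0 \<le> y" "u * x + v * y \<le> 1" by auto
    moreover have "\<exists>p q r. 0 \<le> p \<and> 0 \<le> q \<and> 0 \<le> r \<and> p + q + r = 1 \<and> x = q / u \<and> y = r / v"
      by (rule exI[of _ "1 - u * x - v * y"], rule exI[of _ "u * x"], rule exI[of _ "v * y"])
        (use assms calculation in auto)
    ultimately show "s \<in> {(x, y). \<exists>p q r. 0 \<le> p \<and> 0 \<le> q \<and> 0 \<le> r \<and> p + q + r = 1 \<and> x = q / u \<and> y = r / v}"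
      by simp
  qed (use assms in auto)
  finally show ?thesis .
qed

lemma finite_triangle_points:
  assumes "u > 0" "v > 0"
  shows "finite (triangle_points u v t)"
proof (rule finite_subset)
  show "triangle_points u v t \<subseteq> {..nat \<lfloor>t / u\<rfloor>} \<times> {..nat \<lfloor>t / v\<rfloor>}"
  proof (clarsimp simp: triangle_points_def)
    fix x y assume xy: "u * real x + v * real y \<le> t"
    have "u * real x \<ge> 0" "v * real y \<ge> 0" using assms by auto
    with xy have "u * real x \<le> t" "v * real y \<le> t" by linarith+
    then have "real x \<le> t / u" "real y \<le> t / v"
      using assms by (simp_all add: field_simps)
    then show "x \<le> nat \<lfloor>t / u\<rfloor> \<and> y \<le> nat \<lfloor>t / v\<rfloor>"
      by (simp add: le_nat_floor)
  qed
qed simp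

lemma lattice_count_T_uv:
  assumes "u > 0" "v > 0"
  shows "lattice_count (T_uv u v) n = card (triangle_points u v (real n))"
proof -
  define g where "g = (\<lambda>(x::nat, y::nat). (real x, real y))"
  have scale: "(\<lambda>x. real n *\<^sub>R x) ` T_uv u v = {(x, y). 0 \<le> x \<and> 0 \<le> y \<and> u * x + v * y \<le> real n}"
  proof (cases "n = 0")
    case True
    have "x = 0 \<and> y = 0" if "0 \<le> x" "0 \<le> y" "u * x + v * y \<le> 0" for x y
    proof -
      have "u * x \<ge> 0" "v * y \<ge> 0" using that assms by auto
      with that have "u * x = 0" "v * y = 0" by linarith+
      then show ?thesis using assms by auto
    qed
    moreover have "T_uv u v \<noteq> {}" by (auto simp: T_uv_def)
    ultimately show ?thesis using True by (auto simp: image_constant_conv zero_prod_def)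
  next
    case False
    then have n: "real n > 0" by simp
    show ?thesis
    proof (intro set_eqI iffI)
      fix p assume "p \<in> (\<lambda>x. real n *\<^sub>R x) ` T_uv u v"
      then obtain x y where xy: "0 \<le> x" "0 \<le> y" "u * x + v * y \<le> 1" "p = (real n * x, real n * y)"
        using T_uv_eq[OF assms] by auto
      have "u * (real n * x) + v * (real n * y) = real n * (u * x + v * y)"
        by (simp add: algebra_simps)
      also have "\<dots> \<le> real n * 1" using xy n by (intro mult_left_mono) auto
      finally show "p \<in> {(x, y). 0 \<le> x \<and> 0 \<le> y \<and> u * x + v * y \<le> real n}"
        using xy by simp
    next
      fix p assume "p \<in> {(x, y). 0 \<le> x \<and> 0 \<le> y \<and> u * x + v * y \<le> real n}"
      then obtain x y where xy: "0 \<le> x" "0 \<le> y" "u * x + v * y \<le> real n" "p = (x, y)"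
        by auto
      have "u * (x / n) + v * (y / n) = (u * x + v * y) / n"
        by (simp add: add_divide_distrib)
      also have "\<dots> \<le> 1" using xy n by simp
      finally have "(x / n, y / n) \<in> T_uv u v"
        using xy n by (simp add: T_uv_eq[OF assms])
      then show "p \<in> (\<lambda>x. real n *\<^sub>R x) ` T_uv u v"
        using xy n by (intro image_eqI[of _ _ "(x / n, y / n)"]) auto
    qed
  qed
  have "((\<lambda>x. real n *\<^sub>R x) ` T_uv u v) \<inter> Z2 = g ` triangle_points u v n"
  proof (intro set_eqI iffI)
    fix p assume "p \<in> ((\<lambda>x. real n *\<^sub>R x) ` T_uv u v) \<inter> Z2"
    then obtain i j :: int where ij: "p = (of_int i, of_int j)" "i \<ge> 0" "j \<ge> 0"
      "u * of_int i + v * of_int j \<le> real n"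
      unfolding scale Z2_def by auto
    then show "p \<in> g ` triangle_points u v n"
      by (intro image_eqI[of _ _ "(nat i, nat j)"]) (auto simp: g_def triangle_points_def)
  next
    fix p assume "p \<in> g ` triangle_points u v n"
    then obtain x y :: nat where p: "p = (real x, real y)" "u * real x + v * real y \<le> real n"
      by (auto simp: g_def triangle_points_def)
    have "p = (of_int (int x), of_int (int y))" using p by simp
    then have "p \<in> Z2" unfolding Z2_def by blast
    with p show "p \<in> ((\<lambda>x. real n *\<^sub>R x) ` T_uv u v) \<inter> Z2"
      unfolding scale by simp
  qed
  moreover have "inj_on g (triangle_points u v n)"
    by (auto simp: inj_on_def g_def)
  ultimately show ?thesis
    by (simp add: lattice_count_def card_image)
qed

text \<open>Translating by \<open>(1, 1)\<close> leaves out only the points on the two axes.\<close>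
lemma card_triangle_points_step:
  assumes "u > 0" "v > 0" "t \<ge> 0"
  shows "real (card (triangle_points u v (t + (u + v))))
    = real (card (triangle_points u v t)) + of_int \<lfloor>(t + (u + v)) / u\<rfloor> + of_int \<lfloor>(t + (u + v)) / v\<rfloor> + 1"
proof -
  define t' where "t' = t + (u + v)"
  have t': "t' \<ge> 0" using assms by (simp add: t'_def)
  define S1 where "S1 = map_prod Suc Suc ` triangle_points u v t"
  \<comment> \<open>The origin is counted in \<open>S2\<close> and left out of \<open>S3\<close>,
    whence the single \<open>+ 1\<close>.\<close>
  define S2 where "S2 = (\<lambda>x. (x, 0::nat)) ` {..nat \<lfloor>t' / u\<rfloor>}"
  define S3 where "S3 = (\<lambda>y. (0::nat, Suc y)) ` {..<nat \<lfloor>t' / v\<rfloor>}"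
  have floor_iff: "x \<le> nat \<lfloor>t' / w\<rfloor> \<longleftrightarrow> w * real x \<le> t'" if "w > 0" for w x
  proof -
    have "t' / w \<ge> 0" using t' that by simp
    then have "x \<le> nat \<lfloor>t' / w\<rfloor> \<longleftrightarrow> real x \<le> t' / w"
      by (simp add: le_nat_iff le_floor_iff)
    then show ?thesis using that by (simp add: field_simps)
  qed
  have "triangle_points u v t' = S1 \<union> (S2 \<union> S3)"
  proof (intro set_eqI)
    fix p :: "nat \<times> nat"
    obtain x y where p: "p = (x, y)" by fastforce
    consider "y = 0" | y' where "x = 0" "y = Suc y'" | x' y' where "x = Suc x'" "y = Suc y'"
      by (cases x; cases y) auto
    then show "p \<in> triangle_points u v t' \<longleftrightarrow> p \<in> S1 \<union> (S2 \<union> S3)"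
    proof cases
      case 1
      then show ?thesis
        using floor_iff[of u x] assms by (auto simp: p triangle_points_def S1_def S2_def S3_def)
    next
      case 2
      then show ?thesis
        using floor_iff[of v y] assms by (auto simp: p triangle_points_def S1_def S2_def S3_def)
    next
      case 3
      then show ?thesis
        by (auto simp: p triangle_points_def S1_def S2_def S3_def t'_def algebra_simps)
    qed
  qed
  moreover have "finite S1" "finite S2" "finite S3"
    using assms by (auto simp: S1_def S2_def S3_def finite_triangle_points)
  moreover have "S1 \<inter> (S2 \<union> S3) = {}" "S2 \<inter> S3 = {}"
    by (auto simp: S1_def S2_def S3_def)
  ultimately have "card (triangle_points u v t') = card S1 + (card S2 + card S3)"
    by (simp add: card_Un_disjoint)
  moreover have "card S1 = card (triangle_points u v t)"
    unfolding S1_def by (intro card_image) (auto simp: inj_on_def)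
  moreover have "card S2 = nat \<lfloor>t' / u\<rfloor> + 1" "card S3 = nat \<lfloor>t' / v\<rfloor>"
    unfolding S2_def S3_def by (subst card_image; auto simp: inj_on_def)+
  moreover have "\<lfloor>t' / u\<rfloor> \<ge> 0" "\<lfloor>t' / v\<rfloor> \<ge> 0"
    using t' assms by auto
  ultimately show ?thesis
    by (simp add: t'_def)
qed

text \<open>Subtracting \<open>z\<close> from \<open>g\<close> borrows 1 exactly if
  \<open>frac g < frac z\<close>. With \<open>g = t * c\<close> and \<open>z = t / u\<close>, the
  remaining term \<open>g - z\<close> is \<open>t / v\<close>, so both axis counts reduce to a
  rational part and one indicator.\<close>

lemma floor_add_floor_diff:
  fixes g z :: real
  shows "of_int \<lfloor>z\<rfloor> + of_int \<lfloor>g - z\<rfloor> = g - frac g - of_bool (frac g < frac z)"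
proof -
  have "\<lfloor>g - z\<rfloor> = \<lfloor>g\<rfloor> - \<lfloor>z\<rfloor> - of_bool (frac g < frac z)"
  proof (rule floor_unique)
    have "g = of_int \<lfloor>g\<rfloor> + frac g" "z = of_int \<lfloor>z\<rfloor> + frac z" by (simp_all add: frac_def)
    moreover have "0 \<le> frac g" "frac g < 1" "0 \<le> frac z" "frac z < 1" by (simp_all add: frac_lt_1)
    ultimately show "of_int (\<lfloor>g\<rfloor> - \<lfloor>z\<rfloor> - of_bool (frac g < frac z)) \<le> g - z"
      and "g - z < of_int (\<lfloor>g\<rfloor> - \<lfloor>z\<rfloor> - of_bool (frac g < frac z)) + 1"
      by (cases "frac g < frac z"; simp; linarith)+
  qed
  then show ?thesis by (simp add: frac_def)
qed

lemma convergent_along_progression: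
  assumes "convergent (X :: nat \<Rightarrow> 'a :: topological_space)" "M > 0"
  shows "convergent (\<lambda>s. X (r + M * s))"
proof -
  have "strict_mono (\<lambda>s. r + M * s)"
    using assms by (auto simp: strict_mono_def)
  from convergent_subseq_convergent[OF assms(1) this] show ?thesis by (simp add: o_def)
qed

section \<open>The counting function for conjugate \<open>u\<close> and \<open>v\<close>\<close>

text \<open>Sum and product of \<open>u\<close> and \<open>v\<close> are rational while
  \<open>u\<close> is irrational, so \<open>u\<close> and \<open>v\<close> are conjugate quadratic
  irrationals.\<close>

locale conjugate_triangle =
  fixes u v :: real and A B :: nat
  assumes pos: "u > 0" "v > 0" and irrational_ratio: "u / v \<notin> \<rat>"
    and rational_sum: "1 / u + 1 / v \<in> \<rat>"
    and fraction: "coprime A B" "B > 0" "u + v = real A / real B"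
begin

definition c where "c = 1 / u + 1 / v"

definition f where "f n = real (lattice_count (T_uv u v) n)"

definition W where "W = window_sum (1 / u) c (real A / real B) B"

text \<open>As \<open>u + v = A / B\<close>, this is \<open>1 / (2 * u * v)\<close>, the area of the
  triangle.\<close>

definition \<alpha> where "\<alpha> = real B * c / (2 * real A)"

text \<open>Removing the quadratic main term cancels the linear growth of
  \<open>f (n + A) - f n\<close> and leaves the bounded step \<open>K - W n\<close>.\<close>

definition e where "e n = f n - \<alpha> * (real n)\<^sup>2"

definition K where "K = (\<Sum>j=1..B. real j * (real A / real B) * c + 1) - \<alpha> * (real A)\<^sup>2"

lemma A_pos: "A > 0"
  using pos fraction by (cases "A = 0") auto

lemma c_pos: "c > 0"
  using pos by (simp add: c_def add_pos_pos)

lemma irrational: "1 / u \<notin> \<rat>"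
proof
  assume "1 / u \<in> \<rat>"
  then have "u \<in> \<rat>" using Rats_divide[of 1 "1 / u"] by simp
  moreover have "v = real A / real B - u"
    using fraction by simp
  ultimately have "u \<in> \<rat>" "v \<in> \<rat>" by auto
  then show False using irrational_ratio by simp
qed

lemma c_denominator: obtains M :: nat where "M > 0" "real M * c \<in> \<int>"
proof -
  obtain p q :: int where "q > 0" "c = of_int p / of_int q"
    using rational_sum by (auto simp: c_def elim: Rats_cases')
  then show thesis by (intro that[of "nat q"]) auto
qed

text \<open>Each of \<open>B\<close> translations by \<open>(1, 1)\<close> enlarges the size by
  \<open>u + v = A / B\<close>, so together they lead from \<open>n\<close> to
  \<open>n + A\<close>.\<close>

lemma count_step: "f (n + A) = f n + real B * c * real n
    + (\<Sum>j=1..B. real j * (real A / real B) * c + 1) - W n"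
proof -
  define a where "a = real A / real B"
  have a: "u + v = a" "a > 0" using fraction pos by (auto simp: a_def)
  define N where "N = (\<lambda>t. real (card (triangle_points u v t)))"
  have step: "N (real n + real (Suc m) * a) = N (real n + real m * a)
      + ((real n + real (Suc m) * a) * c + 1
         - (frac ((real n + real (Suc m) * a) * c)
            + of_bool (frac ((real n + real (Suc m) * a) * c) < frac ((real n + real (Suc m) * a) * (1 / u)))))" for m
  proof -
    define T where "T = real n + real (Suc m) * a"
    have T: "real n + real m * a + (u + v) = T" by (simp add: T_def a algebra_simps)
    have "T / v = T * c - T / u"
      by (simp add: c_def algebra_simps)
    moreover have "N T = N (real n + real m * a) + of_int \<lfloor>T / u\<rfloor> + of_int \<lfloor>T / v\<rfloor> + 1"
      using card_triangle_points_step[of u v "real n + real m * a"] pos a T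
      by (simp add: N_def)
    ultimately show ?thesis
      using floor_add_floor_diff[of "T / u" "T * c"] unfolding T_def[symmetric] by simp
  qed
  have "N (real n + real m * a) = N (real n) + (\<Sum>j=1..m. (real n + real j * a) * c + 1)
      - window_sum (1 / u) c a m n" for m
    by (induction m) (simp_all add: window_sum_def step del: of_nat_Suc)
  from this[of B] have "N (real n + real A) = N (real n) + (\<Sum>j=1..B. (real n + real j * a) * c + 1) - W n"
    using fraction(2) by (simp add: a_def W_def)
  moreover have "(\<Sum>j=1..B. (real n + real j * a) * c + 1)
      = real B * c * real n + (\<Sum>j=1..B. real j * a * c + 1)"
    by (simp add: algebra_simps sum.distrib)
  ultimately show ?thesis
    by (simp add: f_def N_def lattice_count_T_uv pos a_def)
qed

lemma e_step: "e (n + A) = e n + (K - W n)"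
proof -
  have "\<alpha> * (real (n + A))\<^sup>2 = \<alpha> * (real n)\<^sup>2 + real B * c * real n + \<alpha> * (real A)\<^sup>2"
    using A_pos by (simp add: \<alpha>_def power2_eq_square field_simps)
  then show ?thesis
    by (simp add: e_def count_step K_def)
qed

lemma W_bound: "\<bar>K - W n\<bar> \<le> \<bar>K\<bar> + 2 * real B"
proof -
  have "0 \<le> W n"
    unfolding W_def window_sum_def by (intro sum_nonneg) auto
  moreover have "W n \<le> (\<Sum>j=1..B. 2)"
    unfolding W_def window_sum_def
  proof (rule sum_mono)
    show "frac x + of_bool (frac x < frac y) \<le> 2" for x y :: real
      using frac_lt_1[of x] by auto
  qed
  ultimately show ?thesis by simp
qed

lemma Ints_if_difference_convergent:
  fixes b :: "nat \<Rightarrow> complex"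
  assumes M: "M > 0" "real M * c \<in> \<int>" and b: "b i\<^sub>0 \<noteq> 0" "i\<^sub>0 \<le> k"
    and conv: "\<And>r. convergent (\<lambda>s. \<Sum>i\<le>k. b i * of_real (K - W (r + M * s + i)))"
    and j: "j \<in> {1..B}"
  shows "(real n + real j * (real A / real B)) * c \<in> \<int>"
proof (rule window_sum_convergent_imp_Ints[where \<theta> = "1 / u" and b = b and i\<^sub>0 = i\<^sub>0 and k = k and M = M])
  show "c \<in> \<rat>" using rational_sum by (simp add: c_def)
  show "convergent (\<lambda>s. \<Sum>i\<le>k. b i * of_real (window_sum (1 / u) c (real A / real B) B (r + M * s + i)))" for r
  proof -
    have "(\<lambda>s. (\<Sum>i\<le>k. b i * of_real K) - (\<Sum>i\<le>k. b i * of_real (K - W (r + M * s + i))))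
        = (\<lambda>s. \<Sum>i\<le>k. b i * of_real (W (r + M * s + i)))"
      by (simp add: algebra_simps sum_subtractf)
    moreover have "convergent (\<lambda>s. (\<Sum>i\<le>k. b i * of_real K) - (\<Sum>i\<le>k. b i * of_real (K - W (r + M * s + i))))"
      by (intro convergent_diff convergent_const conv)
    ultimately show ?thesis by (simp add: W_def)
  qed
qed (fact irrational fraction A_pos M b j)+

text \<open>Inserting \<open>f n = e n + \<alpha> * n ^ 2\<close> gives a recurrence for
  \<open>e\<close> with a polynomial right-hand side \<open>Q\<close>. Its leading coefficients then
  yield a convergent combination of the steps \<open>K - W\<close>.\<close>

lemma P_recursive_imp_Ints:
  assumes "P_recursive (\<lambda>n. of_nat (lattice_count (T_uv u v) n))" and j: "j \<in> {1..B}"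
  shows "(real n + real j * (real A / real B)) * c \<in> \<int>"
proof -
  obtain k and p :: "nat \<Rightarrow> complex poly" where nz: "\<exists>i\<le>k. p i \<noteq> 0"
    and rec: "\<And>n. (\<Sum>i\<le>k. poly (p i) (of_nat (n + i)) * of_nat (lattice_count (T_uv u v) (n + i))) = 0"
    using assms unfolding P_recursive_def by blast
  define P where "P = (\<lambda>i. pcompose (p i) [:of_nat i, 1:])"
  define Q where "Q = - (\<Sum>i\<le>k. P i * smult (of_real \<alpha>) ([:of_nat i, 1:]\<^sup>2))"
  define I where "I = {i. i \<le> k \<and> P i \<noteq> 0}"
  have P0: "P i = 0 \<longleftrightarrow> p i = 0" for i
    by (simp add: P_def pcompose_eq_0_iff)
  have I: "finite I" "I \<noteq> {}" using nz by (auto simp: I_def P0)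
  \<comment> \<open>The maximum over the nonzero \<open>P i\<close> guarantees that some coefficient
    at \<open>D\<close> is nonzero.\<close>
  define D where "D = Max ((\<lambda>i. degree (P i)) ` I)"
  have D: "degree (P i) \<le> D" if "i \<le> k" for i
    using that I by (cases "P i = 0") (auto simp: D_def I_def)
  have "D \<in> (\<lambda>i. degree (P i)) ` I"
    unfolding D_def using I by (intro Max_in) auto
  then obtain i\<^sub>0 where i0: "i\<^sub>0 \<le> k" "coeff (P i\<^sub>0) D \<noteq> 0"
    by (auto simp: I_def)
  have "convergent (\<lambda>n. \<Sum>i\<le>k. coeff (P i) D * of_real (K - W (n + i)))"
  proof (rule leading_coeff_combination_convergent[OF A_pos])
    show "complex_of_real (e (n + A)) = of_real (e n) + of_real (K - W n)" for n
      by (simp add: e_step)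
    show "norm (complex_of_real (K - W n)) \<le> \<bar>K\<bar> + 2 * real B" for n
      unfolding norm_of_real by (rule W_bound)
    show "(\<Sum>i\<le>k. poly (P i) (of_nat n) * of_real (e (n + i))) = poly Q (of_nat n)" for n
    proof -
      have "complex_of_real (e (n + i)) = of_nat (lattice_count (T_uv u v) (n + i)) - of_real \<alpha> * (of_nat i + of_nat n)\<^sup>2" for i
        by (simp add: e_def f_def add.commute)
      moreover have "poly (P i) (of_nat n) = poly (p i) (of_nat (n + i))" for i
        by (simp add: P_def poly_pcompose add.commute)
      ultimately show ?thesis
        using rec[of n] by (simp add: Q_def poly_sum right_diff_distrib sum_subtractf mult.left_commute)
    qed
  qed (use D in auto)
  moreover obtain M :: nat where M: "M > 0" "real M * c \<in> \<int>" by (rule c_denominator)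
  ultimately show ?thesis
    using i0 by (intro Ints_if_difference_convergent[OF M _ _ _ j, where b = "\<lambda>i. coeff (P i) D"])
      (auto dest: convergent_along_progression)
qed

text \<open>On each residue class modulo a common period, \<open>e\<close> is a polynomial. The step
  \<open>K - W\<close> is then a bounded polynomial there, hence constant, and the trivial
  combination \<open>k = 0\<close> converges.\<close>

lemma pseudo_rational_imp_Ints:
  assumes "pseudo_rational (T_uv u v)" and j: "j \<in> {1..B}"
  shows "(real n + real j * (real A / real B)) * c \<in> \<int>"
proof -
  obtain d and q :: "nat \<Rightarrow> nat \<Rightarrow> real" where per: "\<And>i. i \<le> d \<Longrightarrow> periodic_nat (q i)"
    and f_eq: "\<And>t. t > 0 \<Longrightarrow> f t = (\<Sum>i\<le>d. q i t * real t ^ i)"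
    using assms unfolding pseudo_rational_def quasipolynomial_def f_def by blast
  from per have "\<exists>N. \<forall>i\<le>d. N i > 0 \<and> (\<forall>t. q i (t + N i) = q i t)"
    unfolding periodic_nat_def by (intro choice) blast
  then obtain N where N: "\<And>i. i \<le> d \<Longrightarrow> N i > 0" "\<And>i t. i \<le> d \<Longrightarrow> q i (t + N i) = q i t"
    by blast
  obtain M0 :: nat where M0: "M0 > 0" "real M0 * c \<in> \<int>" by (rule c_denominator)
  \<comment> \<open>A multiple of every period \<open>N i\<close> and of a denominator of
    \<open>c\<close>.\<close>
  define M where "M = M0 * (\<Prod>i\<le>d. N i)"
  have "M > 0" using N M0 by (auto simp: M_def)
  have "real M * c = real (\<Prod>i\<le>d. N i) * (real M0 * c)" by (simp add: M_def)
  also have "\<dots> \<in> \<int>" by (rule Ints_mult[OF Ints_of_nat M0(2)])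
  finally have Mc: "real M * c \<in> \<int>" .
  have q_mult: "q i (t + N i * s) = q i t" if "i \<le> d" for i t s
  proof (induction s)
    case (Suc s)
    then show ?case using N(2)[OF that, of "t + N i * s"] by (simp add: algebra_simps)
  qed simp
  have q_per: "q i (t + M * s) = q i t" if "i \<le> d" for i t s
  proof -
    have "N i dvd M" unfolding M_def using that by (intro dvd_mult dvd_prodI) auto
    then obtain l where "M = N i * l" by blast
    then show ?thesis using q_mult[OF that, of t "l * s"] by (simp add: mult.assoc)
  qed
  define E where "E = (\<lambda>m. (\<Sum>i\<le>d. smult (of_real (q i m)) ([:of_nat m, of_nat M:] ^ i))
      - smult (of_real \<alpha>) ([:of_nat m, of_nat M:]\<^sup>2) :: complex poly)"
  have E: "complex_of_real (e (m + M * s)) = poly (E m) (of_nat s)" if "m > 0" for m s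
    using that by (simp add: E_def e_def f_eq q_per poly_sum algebra_simps)
  have conv: "convergent (\<lambda>s. complex_of_real (K - W (r + M * s)))" for r
  proof -
    \<comment> \<open>The base is \<open>r + M\<close> instead of \<open>r\<close>, since the
      quasipolynomial formula holds only at positive arguments and \<open>r\<close> may be
      0.\<close>
    define G where "G = E (r + M + A) - E (r + M)"
    have G: "complex_of_real (K - W (r + M * Suc s)) = poly G (of_nat s)" for s
    proof -
      have "K - W (r + M * Suc s) = e (r + M + A + M * s) - e (r + M + M * s)"
        using e_step[of "r + M * Suc s"] by (simp add: algebra_simps)
      then have "complex_of_real (K - W (r + M * Suc s)) = of_real (e (r + M + A + M * s)) - of_real (e (r + M + M * s))"
        by (simp only: of_real_diff)
      then show ?thesis using E[of "r + M + A" s] E[of "r + M" s] \<open>M > 0\<close> by (simp add: G_def)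
    qed
    have "degree G = 0"
    proof (rule degree_eq_0_if_bounded_on_nats, rule BseqI')
      show "norm (poly G (of_nat s)) \<le> \<bar>K\<bar> + 2 * real B" for s
        unfolding G[symmetric] norm_of_real by (rule W_bound)
    qed
    then obtain g where "G = [:g:]" by (rule degree_eq_zeroE)
    with G have "(\<lambda>s. complex_of_real (K - W (r + M * Suc s))) = (\<lambda>_. g)" by auto
    then have "convergent (\<lambda>s. complex_of_real (K - W (r + M * Suc s)))"
      by (simp add: convergent_const)
    then show ?thesis by (subst (asm) convergent_Suc_iff)
  qed
  show ?thesis
    using conv by (intro Ints_if_difference_convergent[OF \<open>M > 0\<close> Mc _ _ _ j, where b = "\<lambda>_. 1" and k = 0]) auto
qed

text \<open>Every \<open>frac g\<close> vanishes while \<open>frac z\<close> is positive by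
  irrationality, so each summand of \<open>W\<close> is 1. Then \<open>e\<close> has a constant step
  and is a linear function plus an \<open>A\<close>-periodic one.\<close>

lemma Ints_imp_pseudo_rational:
  assumes "\<And>n j. j \<in> {1..B} \<Longrightarrow> (real n + real j * (real A / real B)) * c \<in> \<int>"
  shows "pseudo_rational (T_uv u v)"
proof -
  have "(real n + real j * (real A / real B)) * (1 / u) \<notin> \<int>" if "j \<in> {1..B}" for n j
  proof
    define x where "x = real n + real j * (real A / real B)"
    assume "(real n + real j * (real A / real B)) * (1 / u) \<in> \<int>"
    then have "(x * (1 / u)) / x \<in> \<rat>"
      unfolding x_def[symmetric] by (intro Rats_divide) (auto simp: x_def dest: subsetD[OF Ints_subset_Rats])
    moreover have "real j * (real A / real B) > 0" using that A_pos fraction by auto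
    then have "x \<noteq> 0" unfolding x_def by linarith
    ultimately show False using irrational by simp
  qed
  then have "frac ((real n + real j * (real A / real B)) * c)
      + of_bool (frac ((real n + real j * (real A / real B)) * c)
          < frac ((real n + real j * (real A / real B)) * (1 / u))) = (1::real)" if "j \<in> {1..B}" for n j
    using assms[OF that, of n] that by (simp only: frac_eq_0_iff[THEN iffD2] frac_gt_0_iff) simp
  then have "W n = (\<Sum>j=1..B. 1)" for n
    unfolding W_def window_sum_def by (intro sum.cong) auto
  moreover define \<kappa> where "\<kappa> = (K - real B) / real A"
  ultimately have step: "e (n + A) = e n + \<kappa> * real A" for n
    using e_step[of n] A_pos by simp
  \<comment> \<open>The periodic part of \<open>e\<close> is the constant coefficient, its slope
    \<open>\<kappa>\<close> the linear one.\<close>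
  define q where "q = (\<lambda>(i::nat) t. if i = 0 then e t - \<kappa> * real t
      else if i = 1 then \<kappa> else \<alpha>)"
  have "periodic_nat (q i)" for i :: nat
    unfolding periodic_nat_def using A_pos step
    by (intro exI[of _ A]) (auto simp: q_def algebra_simps)
  moreover have "f t = (\<Sum>i\<le>2. q i t * real t ^ i)" for t
    by (simp add: q_def e_def eval_nat_numeral)
  ultimately show ?thesis
    unfolding pseudo_rational_def quasipolynomial_def f_def[symmetric] by blast
qed

lemma P_recursive_imp_pseudo_rational:
  assumes "P_recursive (\<lambda>n. of_nat (lattice_count (T_uv u v) n))"
  shows "pseudo_rational (T_uv u v)"
  using P_recursive_imp_Ints[OF assms] by (rule Ints_imp_pseudo_rational)

text \<open>The integers obtained for \<open>n = 1\<close> and \<open>n = 0\<close> with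
  \<open>j = 1\<close> differ by \<open>c\<close>, so \<open>c\<close> is a positive integer.
  Applied to scaled triangles, this bounds the scaling factor.\<close>

lemma pseudo_rational_imp_c_ge_1:
  assumes "pseudo_rational (T_uv u v)"
  shows "1 / u + 1 / v \<ge> 1"
proof -
  have "(real n + real 1 * (real A / real B)) * c \<in> \<int>" for n
    using pseudo_rational_imp_Ints[OF assms, of 1 n] fraction by auto
  from Ints_diff[OF this[of 1] this[of 0]] have "c \<in> \<int>"
    by (simp add: algebra_simps)
  then obtain z where "c = of_int z" by (elim Ints_cases)
  with c_pos have "c \<ge> 1" by simp
  then show ?thesis by (simp add: c_def)
qed

end

section \<open>Scaling down to a primitive triangle\<close>

lemma conjugate_triangle_exists:
  assumes "u > 0" "v > 0" "u / v \<notin> \<rat>" "1 / u + 1 / v \<in> \<rat>" "u + v \<in> \<rat>"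
  obtains A B where "conjugate_triangle u v A B"
proof -
  from \<open>u + v \<in> \<rat>\<close> obtain p q :: int where pq: "q > 0" "coprime p q" "u + v = of_int p / of_int q"
    by (elim Rats_cases')
  have "of_int p / of_int q > (0::real)" using pq assms by linarith
  with pq have "p > 0" by (simp add: zero_less_divide_iff)
  have "conjugate_triangle u v (nat p) (nat q)"
    using assms pq \<open>p > 0\<close> by unfold_locales (auto simp flip: coprime_int_iff)
  then show thesis by (rule that)
qed

lemma scaled_conjugate_triangle_exists:
  assumes "u > 0" "v > 0" "u / v \<notin> \<rat>" "1 / u + 1 / v \<in> \<rat>" "u + v \<in> \<rat>" "t > 0"
  obtains A B where "conjugate_triangle (real t * u) (real t * v) A B"
proof (rule conjugate_triangle_exists)
  have "1 / (real t * u) + 1 / (real t * v) = (1 / u + 1 / v) / real t"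
    by (simp add: add_divide_distrib mult.commute)
  then show "1 / (real t * u) + 1 / (real t * v) \<in> \<rat>" using assms by auto
  have "real t * u + real t * v = real t * (u + v)"
    by (simp add: algebra_simps)
  then show "real t * u + real t * v \<in> \<rat>" using assms by auto
qed (use assms in auto)

lemma T_uv_scale: "(\<lambda>x. (1 / r) *\<^sub>R x) ` T_uv u v = T_uv (r * u) (r * v)"
  by (simp add: T_uv_def convex_hull_scaling[symmetric])

lemma is_triangle_T_uv:
  assumes "u > 0" "v > 0"
  shows "is_triangle (T_uv u v)"
proof -
  have "\<not> collinear {0, (1 / u, 0), (0, 1 / v)}"
    unfolding collinear_lemma using assms by (auto simp: zero_prod_def)
  then have "\<not> collinear {(0, 0), (1 / u, 0), (0, 1 / v)}"
    unfolding zero_prod_def .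
  then show ?thesis
    unfolding is_triangle_def T_uv_def by blast
qed

theorem theorem1p3:
  fixes u v :: real
  assumes "u > 0" and "v > 0"
    and "u / v \<notin> \<rat>"
    and "1 / u + 1 / v \<in> \<rat>"
    and "u + v \<in> \<rat>"
    and "\<not> (\<exists>(t::nat) T. t > 0 \<and> primitive_pseudo_rational_triangle T \<and>
              T_uv u v = (\<lambda>x. real t *\<^sub>R x) ` T)"
  shows "\<not> P_recursive (\<lambda>n. of_nat (lattice_count (T_uv u v) n))"
proof
  assume "P_recursive (\<lambda>n. of_nat (lattice_count (T_uv u v) n))"
  moreover obtain A B where "conjugate_triangle u v A B"
    using conjugate_triangle_exists[OF assms(1-5)] by blast
  ultimately have "pseudo_rational (T_uv u v)"
    by (rule conjugate_triangle.P_recursive_imp_pseudo_rational[rotated])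
  \<comment> \<open>These are the \<open>t\<close> for which scaling by \<open>1 / t\<close> leaves
    a pseudo-rational triangle. Such a scaling divides \<open>1 / u + 1 / v\<close> by
    \<open>t\<close>, and the result must still be at least 1.\<close>
  define S where "S = {t::nat. t > 0 \<and> pseudo_rational (T_uv (real t * u) (real t * v))}"
  have "S \<subseteq> {..nat \<lfloor>1 / u + 1 / v\<rfloor>}"
  proof
    fix t assume "t \<in> S"
    then have t: "t > 0" "pseudo_rational (T_uv (real t * u) (real t * v))" by (auto simp: S_def)
    obtain A B where "conjugate_triangle (real t * u) (real t * v) A B"
      using scaled_conjugate_triangle_exists[OF assms(1-5) t(1)] by blast
    then have "1 / (real t * u) + 1 / (real t * v) \<ge> 1"
      using t(2) by (rule conjugate_triangle.pseudo_rational_imp_c_ge_1)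
    then have "real t \<le> 1 / u + 1 / v"
      using t(1) assms(1,2) by (simp add: field_simps)
    then show "t \<in> {..nat \<lfloor>1 / u + 1 / v\<rfloor>}" by (simp add: le_nat_floor)
  qed
  then have "finite S" by (rule finite_subset) simp
  have "1 \<in> S" using \<open>pseudo_rational (T_uv u v)\<close> by (simp add: S_def)
  \<comment> \<open>Maximality gives primitivity: a pseudo-rational scaling by a further
    \<open>1 / s\<close> with \<open>s > 1\<close> would put \<open>s * t\<close> into
    \<open>S\<close>.\<close>
  define t where "t = Max S"
  have "t \<in> S" unfolding t_def using \<open>finite S\<close> \<open>1 \<in> S\<close> by (intro Max_in) auto
  then have t: "t > 0" "pseudo_rational (T_uv (real t * u) (real t * v))" by (auto simp: S_def)
  have "primitive_pseudo_rational_triangle (T_uv (real t * u) (real t * v))"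
    unfolding primitive_pseudo_rational_triangle_def
  proof (intro conjI allI impI)
    show "is_triangle (T_uv (real t * u) (real t * v))"
      using assms t by (intro is_triangle_T_uv) auto
    show "pseudo_rational (T_uv (real t * u) (real t * v))" by fact
    fix s :: nat assume "s > 1"
    then have "s * t > t" using t by simp
    then have "s * t \<notin> S" using Max_ge[OF \<open>finite S\<close>] t_def by (meson leD)
    then show "\<not> pseudo_rational ((\<lambda>x. (1 / real s) *\<^sub>R x) ` T_uv (real t * u) (real t * v))"
      using t \<open>s > 1\<close> unfolding T_uv_scale by (simp add: S_def mult.assoc)
  qed
  moreover have "T_uv u v = (\<lambda>x. real t *\<^sub>R x) ` T_uv (real t * u) (real t * v)"
    using t(1) T_uv_scale[of "1 / real t" "real t * u" "real t * v"] by simp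
  ultimately show False using assms(6) t(1) by blast
qed

end
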